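(* For $\mu\in P$ there exists a unique extremum $\widehat{\mu}_k\in V^*$ of the master function $S_k(\mu,\cdot):V^*\to\mathbb{R}$. The assignment $\mu\mapsto i\widehat{\mu}_k$ defines a $W_0$-equivariant bijection $P\overset{\sim}{\longrightarrow}\mathrm{BAE}_k$.
   Context: Let $V$ be a Euclidean space of dimension $n$ and $V^*$ the dual Euclidean space, with norm $\|\cdot\|$ and inner product $\langle\cdot,\cdot\rangle$ on $V^*$. Let $\Sigma_0\subset V^*$ be a finite, irreducible, reduced crystallographic root system. The co-root $\alpha^\vee\in V$ of $\alpha\in\Sigma_0$ is determined by $\xi(\alpha^\vee)=2\langle\xi,\alpha\rangle/\|\alpha\|^2$ for all $\xi\in V^*$. Fix a basis of $\Sigma_0$, with positive roots $\Sigma_0^+$ and highest root $\varphi$. The Weyl group $W_0$ is generated by the reflections $s_\alpha\xi=\xi-\xi(\alpha^\vee)\alpha$ ($\alpha\in\Sigma_0$) of $V^*$; the action is extended complex linearly to $V_{\mathbb{C}}^*=V^*\oplus iV^*$. The weight lattice is $P=\{\lambda\in V^*: \lambda(\alpha^\vee)\in\mathbb{Z}\ \forall\alpha\in\Sigma_0\}$. The multiplicity function restricted to $\Sigma_0$ is a $W_0$-invariant function $\alpha\mapsto k_\alpha\in\mathbb{R}_{>0}$. (In the paper $k$ is a strictly positive function on the affine root system $\Sigma=\Sigma_0+\mathbb{Z}$, invariant under the affine Weyl group, with $k(a)=k(Da)$, $Da\in\Sigma_0$ the gradient of $a$; only the values on $\Sigma_0$ matter here.) $\mathrm{BAE}_k$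 is the set of all purely imaginary $\lambda\in iV^*$ satisfying the Bethe ansatz equations $$e^{w\lambda(\varphi^\vee)}=\prod_{\alpha\in\Sigma_0^+}\left(\frac{w\lambda(\alpha^\vee)-k_\alpha}{w\lambda(\alpha^\vee)+k_\alpha}\right)^{\alpha(\varphi^\vee)}\qquad \forall\, w\in W_0.$$ The master function $S_k:P\times V^*\to\mathbb{R}$ is $$S_k(\mu,\xi)=\frac12\|\xi\|^2-2\pi\langle\mu,\xi\rangle+\frac12\sum_{\alpha\in\Sigma_0}\|\alpha\|^2\int_0^{\xi(\alpha^\vee)}\arctan\left(\frac{t}{k_\alpha}\right)dt.$$ An extremum of $S_k(\mu,\cdot)$ is a vector in $V^*$ at which all its directional derivatives vanish. *)

theory Defs
  imports "HOL-Analysis.Analysis"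
begin

text \<open>
  The type \<open>'a\<close> is the Euclidean space V* in which the roots live. Its dual V is identified
  with \<open>'a\<close> through the inner product, so that the value of \<open>\<xi>\<close> at \<open>v\<close> is \<open>\<xi> \<bullet> v\<close>.
\<close>

subsection \<open>Root systems\<close>

definition coroot :: "'a::euclidean_space \<Rightarrow> 'a" where
  "coroot \<alpha> = (2 / (norm \<alpha>)\<^sup>2) *\<^sub>R \<alpha>"

lemma coroot_unique:
  fixes \<alpha> v :: "'a::euclidean_space"
  shows "v = coroot \<alpha> \<longleftrightarrow> (\<forall>\<xi>. \<xi> \<bullet> v = 2 * (\<xi> \<bullet> \<alpha>) / (norm \<alpha>)\<^sup>2)"
  by (subst vector_eq_ldot[symmetric]) (simp add: coroot_def)

definition root_reflection :: "'a::euclidean_space \<Rightarrow> 'a \<Rightarrow> 'a" where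
  "root_reflection \<alpha> \<xi> = \<xi> - (\<xi> \<bullet> coroot \<alpha>) *\<^sub>R \<alpha>"

definition root_system :: "'a::euclidean_space set \<Rightarrow> bool" where
  "root_system R \<longleftrightarrow> finite R \<and> 0 \<notin> R \<and> span R = UNIV \<and>
     (\<forall>\<alpha>\<in>R. \<forall>\<beta>\<in>R. root_reflection \<alpha> \<beta> \<in> R)"

definition crystallographic :: "'a::euclidean_space set \<Rightarrow> bool" where
  "crystallographic R \<longleftrightarrow> (\<forall>\<alpha>\<in>R. \<forall>\<beta>\<in>R. \<beta> \<bullet> coroot \<alpha> \<in> \<int>)"

definition reduced_roots :: "'a::euclidean_space set \<Rightarrow> bool" where
  "reduced_roots R \<longleftrightarrow> (\<forall>\<alpha>\<in>R. \<forall>c. c *\<^sub>R \<alpha> \<in> R \<longrightarrow> c = 1 \<or> c = -1)"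

definition irreducible_roots :: "'a::euclidean_space set \<Rightarrow> bool" where
  "irreducible_roots R \<longleftrightarrow> R \<noteq> {} \<and>
     \<not> (\<exists>A B. A \<noteq> {} \<and> B \<noteq> {} \<and> A \<inter> B = {} \<and> A \<union> B = R \<and> (\<forall>\<alpha>\<in>A. \<forall>\<beta>\<in>B. \<alpha> \<bullet> \<beta> = 0))"

definition root_basis :: "'a::euclidean_space set \<Rightarrow> 'a set \<Rightarrow> bool" where
  "root_basis R \<Delta> \<longleftrightarrow> \<Delta> \<subseteq> R \<and> independent \<Delta> \<and>
     (\<forall>\<alpha>\<in>R. \<exists>c :: 'a \<Rightarrow> int. \<alpha> = (\<Sum>\<delta>\<in>\<Delta>. of_int (c \<delta>) *\<^sub>R \<delta>) \<and>
        ((\<forall>\<delta>\<in>\<Delta>. 0 \<le> c \<delta>) \<or> (\<forall>\<delta>\<in>\<Delta>. c \<delta> \<le> 0)))"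

definition nonneg_combinations :: "'a::euclidean_space set \<Rightarrow> 'a set" where
  "nonneg_combinations \<Delta> = {\<Sum>\<delta>\<in>\<Delta>. of_nat (c \<delta>) *\<^sub>R \<delta> | c :: 'a \<Rightarrow> nat. True}"

definition positive_roots :: "'a::euclidean_space set \<Rightarrow> 'a set \<Rightarrow> 'a set" where
  "positive_roots R \<Delta> = R \<inter> nonneg_combinations \<Delta>"

definition highest_root :: "'a::euclidean_space set \<Rightarrow> 'a set \<Rightarrow> 'a \<Rightarrow> bool" where
  "highest_root R \<Delta> \<phi> \<longleftrightarrow> \<phi> \<in> R \<and> (\<forall>\<alpha>\<in>R. \<phi> - \<alpha> \<in> nonneg_combinations \<Delta>)"

text \<open>
  As reflections are involutions, the closure of the identity under composition with
  reflections is already the group they generate.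
\<close>

inductive_set weyl_group :: "'a::euclidean_space set \<Rightarrow> ('a \<Rightarrow> 'a) set"
  for R :: "'a set" where
  id: "id \<in> weyl_group R"
| reflect: "\<alpha> \<in> R \<Longrightarrow> w \<in> weyl_group R \<Longrightarrow> root_reflection \<alpha> \<circ> w \<in> weyl_group R"

definition weight_lattice :: "'a::euclidean_space set \<Rightarrow> 'a set" where
  "weight_lattice R = {\<mu>. \<forall>\<alpha>\<in>R. \<mu> \<bullet> coroot \<alpha> \<in> \<int>}"

definition multiplicity_function :: "'a::euclidean_space set \<Rightarrow> ('a \<Rightarrow> real) \<Rightarrow> bool" where
  "multiplicity_function R k \<longleftrightarrow>
     (\<forall>\<alpha>\<in>R. 0 < k \<alpha>) \<and> (\<forall>w\<in>weyl_group R. \<forall>\<alpha>\<in>R. k (w \<alpha>) = k \<alpha>)"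

subsection \<open>Bethe ansatz equations\<close>

text \<open>
  The pair \<open>(\<xi>, \<eta>)\<close> stands for the element \<open>\<xi> + i\<eta>\<close> of the complexification of V*.
\<close>

type_synonym 'a complexified = "'a \<times> 'a"

definition imag :: "'a::euclidean_space \<Rightarrow> 'a complexified" where
  "imag \<eta> = (0, \<eta>)"

definition complex_eval :: "'a::euclidean_space complexified \<Rightarrow> 'a \<Rightarrow> complex" where
  "complex_eval z v = Complex (fst z \<bullet> v) (snd z \<bullet> v)"

definition complex_action ::
  "('a::euclidean_space \<Rightarrow> 'a) \<Rightarrow> 'a complexified \<Rightarrow> 'a complexified" where
  "complex_action w z = (w (fst z), w (snd z))"

text \<open>
  The exponents \<open>\<alpha> \<bullet> coroot \<phi>\<close> are integers when R is crystallographic; the floor only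
  changes their type.
\<close>

definition BAE ::
  "'a::euclidean_space set \<Rightarrow> 'a set \<Rightarrow> 'a \<Rightarrow> ('a \<Rightarrow> real) \<Rightarrow> 'a complexified set" where
  "BAE R \<Delta> \<phi> k = {z \<in> range imag. \<forall>w\<in>weyl_group R.
     exp (complex_eval (complex_action w z) (coroot \<phi>)) =
     (\<Prod>\<alpha>\<in>positive_roots R \<Delta>.
        ((complex_eval (complex_action w z) (coroot \<alpha>) - of_real (k \<alpha>)) /
         (complex_eval (complex_action w z) (coroot \<alpha>) + of_real (k \<alpha>)))
        powi \<lfloor>\<alpha> \<bullet> coroot \<phi>\<rfloor>)}"

subsection \<open>The master function\<close>

definition master_function ::
  "'a::euclidean_space set \<Rightarrow> ('a \<Rightarrow> real) \<Rightarrow> 'a \<Rightarrow> 'a \<Rightarrow> real" where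
  "master_function R k \<mu> \<xi> =
     1/2 * (norm \<xi>)\<^sup>2 - 2 * pi * (\<mu> \<bullet> \<xi>) +
     1/2 * (\<Sum>\<alpha>\<in>R. (norm \<alpha>)\<^sup>2 * (LBINT t=ereal 0..ereal (\<xi> \<bullet> coroot \<alpha>). arctan (t / k \<alpha>)))"

definition is_extremum :: "('a::euclidean_space \<Rightarrow> real) \<Rightarrow> 'a \<Rightarrow> bool" where
  "is_extremum f \<xi> \<longleftrightarrow> (\<forall>v. ((\<lambda>t. f (\<xi> + t *\<^sub>R v)) has_real_derivative 0) (at 0))"

definition mu_hat :: "'a::euclidean_space set \<Rightarrow> ('a \<Rightarrow> real) \<Rightarrow> 'a \<Rightarrow> 'a" where
  "mu_hat R k \<mu> = (THE \<xi>. is_extremum (master_function R k \<mu>) \<xi>)"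

end

theory Submission
  imports Defs "HOL-Library.Z2"
begin

text \<open>
  The gradient of the master function at \<open>\<xi>\<close> is \<open>G \<xi> - 2\<pi>\<mu>\<close>, where \<open>G\<close> differs from the identity
  by a bounded, monotone, Weyl-equivariant map. Monotonicity makes \<open>G\<close> injective, and Brouwer's
  theorem applied to \<open>\<xi> \<mapsto> \<xi> + c - G \<xi>\<close> makes it surjective, so extrema correspond to the lattice
  \<open>2\<pi>P\<close> under \<open>G\<close>.

  On the other side, \<open>(ix - k)/(ix + k) = - exp (-2i arctan (x/k))\<close>, so the logarithm of a Bethe
  equation says that \<open>G (w \<xi>)\<close> pairs with the coroot of \<open>\<phi>\<close> to an element of \<open>2\<pi>\<int>\<close>; the signs cancel
  because the sum of the positive roots pairs evenly with the coroot of \<open>\<phi>\<close>. As \<open>\<phi>\<close> is a longest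
  root, the coroots in its Weyl orbit generate the coroot lattice, so these conditions together
  say \<open>G \<xi> \<in> 2\<pi>P\<close>.
\<close>

section \<open>The gradient of the master function\<close>

text \<open>The gradient of the integral part of \<open>master_function\<close>: differentiating
  each term produces half the squared length of \<alpha> times its coroot, which is \<alpha>
  itself.\<close>

definition arctan_sum :: "'a::euclidean_space set \<Rightarrow> ('a \<Rightarrow> real) \<Rightarrow> 'a \<Rightarrow> 'a" where
  "arctan_sum R k \<xi> = (\<Sum>\<alpha>\<in>R. arctan (\<xi> \<bullet> coroot \<alpha> / k \<alpha>) *\<^sub>R \<alpha>)"

lemma has_real_derivative_arctan_integral:
  fixes c x :: real
  assumes "0 < c"
  shows "((\<lambda>u. LBINT t=ereal 0..ereal u. arctan (t / c)) has_real_derivative arctan (x / c)) (at x)"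
proof -
  \<comment> \<open>The interval contains 0 and has x in its interior whatever the sign of x, so the
    derivative within it is the full derivative.\<close>
  define a b where "a = - \<bar>x\<bar> - 1" and "b = \<bar>x\<bar> + 1"
  have "continuous_on {a..b} (\<lambda>t. arctan (t / c))"
    using assms by (intro continuous_intros) auto
  then have "((\<lambda>u. LBINT t=ereal 0..ereal u. arctan (t / c)) has_vector_derivative arctan (x / c))
      (at x within {a..b})"
    by (intro interval_integral_FTC2) (auto simp: a_def b_def)
  moreover have "at x within {a..b} = at x"
    by (rule at_within_Icc_at) (auto simp: a_def b_def)
  ultimately show ?thesis
    by (simp add: has_real_derivative_iff_has_vector_derivative)
qed

lemma has_real_derivative_master_function:
  fixes R :: "'a::euclidean_space set"
  assumes "\<And>\<alpha>. \<alpha> \<in> R \<Longrightarrow> 0 < k \<alpha>"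
  shows "((\<lambda>t. master_function R k \<mu> (\<xi> + t *\<^sub>R v)) has_real_derivative
    (\<xi> + arctan_sum R k \<xi> - (2 * pi) *\<^sub>R \<mu>) \<bullet> v) (at 0)"
proof -
  define F where "F \<alpha> u = (LBINT t=ereal 0..ereal u. arctan (t / k \<alpha>))" for \<alpha> u
  have F: "((\<lambda>t. F \<alpha> (\<xi> \<bullet> coroot \<alpha> + t * (v \<bullet> coroot \<alpha>))) has_real_derivative
      arctan (\<xi> \<bullet> coroot \<alpha> / k \<alpha>) * (v \<bullet> coroot \<alpha>)) (at 0)" if "\<alpha> \<in> R" for \<alpha>
  proof (rule DERIV_chain2[where f = "F \<alpha>"])
    show "(F \<alpha> has_real_derivative arctan (\<xi> \<bullet> coroot \<alpha> / k \<alpha>))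
        (at (\<xi> \<bullet> coroot \<alpha> + 0 * (v \<bullet> coroot \<alpha>)))"
      unfolding F_def
      using has_real_derivative_arctan_integral[OF assms[OF that]] by simp
  qed (auto intro!: derivative_eq_intros)
  have eq: "master_function R k \<mu> (\<xi> + t *\<^sub>R v) =
      1/2 * (\<xi> \<bullet> \<xi> + 2 * t * (\<xi> \<bullet> v) + t * t * (v \<bullet> v)) - 2 * pi * (\<mu> \<bullet> \<xi> + t * (\<mu> \<bullet> v)) +
      1/2 * (\<Sum>\<alpha>\<in>R. (norm \<alpha>)\<^sup>2 * F \<alpha> (\<xi> \<bullet> coroot \<alpha> + t * (v \<bullet> coroot \<alpha>)))" for t
    unfolding master_function_def F_def power2_norm_eq_inner
    by (simp add: inner_add_left inner_add_right inner_commute algebra_simps)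
  \<comment> \<open>The weights of the master function are chosen so that they cancel the
    normalisation of the coroots here.\<close>
  have coroot: "(norm \<alpha>)\<^sup>2 * (v \<bullet> coroot \<alpha>) = 2 * (\<alpha> \<bullet> v)" for \<alpha>
    by (simp add: coroot_def inner_commute)
  have "1/2 * (\<Sum>\<alpha>\<in>R. (norm \<alpha>)\<^sup>2 * (arctan (\<xi> \<bullet> coroot \<alpha> / k \<alpha>) * (v \<bullet> coroot \<alpha>))) =
      arctan_sum R k \<xi> \<bullet> v"
    unfolding arctan_sum_def inner_sum_left sum_distrib_left
    by (intro sum.cong refl) (use coroot in \<open>simp add: mult.left_commute[of "(norm _)\<^sup>2"]\<close>)
  then show ?thesis
    unfolding eq
    by (auto intro!: derivative_eq_intros F simp: algebra_simps inner_add_left inner_diff_left)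
qed

text \<open>All directional derivatives are inner products with one fixed vector, so they all vanish
  exactly when that vector is zero.\<close>

lemma is_extremum_master_function_iff:
  fixes R :: "'a::euclidean_space set"
  assumes "\<And>\<alpha>. \<alpha> \<in> R \<Longrightarrow> 0 < k \<alpha>"
  shows "is_extremum (master_function R k \<mu>) \<xi> \<longleftrightarrow> \<xi> + arctan_sum R k \<xi> = (2 * pi) *\<^sub>R \<mu>"
proof -
  have "is_extremum (master_function R k \<mu>) \<xi> \<longleftrightarrow>
      (\<forall>v. (\<xi> + arctan_sum R k \<xi> - (2 * pi) *\<^sub>R \<mu>) \<bullet> v = 0)"
    unfolding is_extremum_def
    by (metis DERIV_unique has_real_derivative_master_function[where R=R and k=k, OF assms])
  also have "\<dots> \<longleftrightarrow> \<xi> + arctan_sum R k \<xi> - (2 * pi) *\<^sub>R \<mu> = 0"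
    by (metis inner_eq_zero_iff inner_zero_left)
  finally show ?thesis
    by simp
qed

section \<open>Monotonicity and bijectivity of the gradient map\<close>

text \<open>Each root contributes the increment of an increasing function times a positive multiple
  of the increment of its argument, and these have the same sign.\<close>

lemma arctan_sum_monotone:
  fixes R :: "'a::euclidean_space set"
  assumes "\<And>\<alpha>. \<alpha> \<in> R \<Longrightarrow> 0 < k \<alpha>"
  shows "0 \<le> (arctan_sum R k \<xi> - arctan_sum R k \<eta>) \<bullet> (\<xi> - \<eta>)"
proof -
  have "0 \<le> (arctan (\<xi> \<bullet> coroot \<alpha> / k \<alpha>) - arctan (\<eta> \<bullet> coroot \<alpha> / k \<alpha>)) * (\<alpha> \<bullet> (\<xi> - \<eta>))"
    if "\<alpha> \<in> R" for \<alpha>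
  proof -
    define x y where "x = \<xi> \<bullet> coroot \<alpha>" and "y = \<eta> \<bullet> coroot \<alpha>"
    have "\<alpha> \<bullet> (\<xi> - \<eta>) = (norm \<alpha>)\<^sup>2 / 2 * (x - y)"
      by (simp add: x_def y_def coroot_def inner_commute inner_diff_right right_diff_distrib)
    moreover have "0 \<le> (arctan (x / k \<alpha>) - arctan (y / k \<alpha>)) * (x - y)"
      using assms[OF that]
      by (cases "x \<le> y")
        (auto simp: arctan_le_iff divide_right_mono intro: mult_nonpos_nonpos mult_nonneg_nonneg)
    ultimately have "0 \<le> (arctan (x / k \<alpha>) - arctan (y / k \<alpha>)) * (\<alpha> \<bullet> (\<xi> - \<eta>))"
      by (simp only: mult.left_commute) simp
    then show ?thesis
      by (simp only: x_def y_def)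
  qed
  then have "0 \<le> (\<Sum>\<alpha>\<in>R. (arctan (\<xi> \<bullet> coroot \<alpha> / k \<alpha>) - arctan (\<eta> \<bullet> coroot \<alpha> / k \<alpha>)) * (\<alpha> \<bullet> (\<xi> - \<eta>)))"
    by (rule sum_nonneg)
  also have "\<dots> = (arctan_sum R k \<xi> - arctan_sum R k \<eta>) \<bullet> (\<xi> - \<eta>)"
    by (simp add: arctan_sum_def inner_diff_left inner_sum_left sum_subtractf left_diff_distrib)
  finally show ?thesis .
qed

lemma bij_add_arctan_sum:
  fixes R :: "'a::euclidean_space set"
  assumes pos: "\<And>\<alpha>. \<alpha> \<in> R \<Longrightarrow> 0 < k \<alpha>"
  shows "bij (\<lambda>\<xi>. \<xi> + arctan_sum R k \<xi>)"
proof (rule bijI)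
  show "inj (\<lambda>\<xi>. \<xi> + arctan_sum R k \<xi>)"
  proof (rule injI)
    fix \<xi> \<eta>
    assume "\<xi> + arctan_sum R k \<xi> = \<eta> + arctan_sum R k \<eta>"
    then have "arctan_sum R k \<xi> - arctan_sum R k \<eta> = - (\<xi> - \<eta>)"
      by (simp add: algebra_simps)
    \<comment> \<open>A common image makes the monotonicity expression equal to minus the squared
      distance of the two points.\<close>
    with arctan_sum_monotone[where R=R and k=k and \<xi>=\<xi> and \<eta>=\<eta>, OF pos] have "0 \<le> - ((\<xi> - \<eta>) \<bullet> (\<xi> - \<eta>))"
      by (simp only: inner_minus_left)
    then show "\<xi> = \<eta>"
      by (metis eq_iff_diff_eq_0 inner_eq_zero_iff inner_ge_zero neg_0_le_iff_le
          order_antisym)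
  qed
  have "\<exists>y. y + arctan_sum R k y = c" for c :: 'a
  proof -
    \<comment> \<open>Since \<open>arctan\<close> is bounded by \<open>pi / 2\<close>, this bounds
      the norm of \<open>arctan_sum\<close> everywhere, so the map below sends the ball of radius
      \<open>B\<close> about \<open>c\<close> into itself; its fixed point is a preimage of
      \<open>c\<close>.\<close>
    define B where "B = (\<Sum>\<alpha>\<in>R. pi / 2 * norm \<alpha>)"
    have "norm (arctan_sum R k y) \<le> B" for y
      unfolding arctan_sum_def B_def
    proof (rule sum_norm_le)
      fix \<alpha>
      have "\<bar>arctan (y \<bullet> coroot \<alpha> / k \<alpha>)\<bar> \<le> pi / 2"
        using arctan_bounded[of "y \<bullet> coroot \<alpha> / k \<alpha>"] by linarith
      then show "norm (arctan (y \<bullet> coroot \<alpha> / k \<alpha>) *\<^sub>R \<alpha>) \<le> pi / 2 * norm \<alpha>"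
        unfolding norm_scaleR by (rule mult_right_mono) simp
    qed
    then have maps: "(\<lambda>y. c - arctan_sum R k y) \<in> cball c B \<rightarrow> cball c B"
      by (auto simp: dist_norm)
    have "0 \<le> B"
      unfolding B_def by (intro sum_nonneg) auto
    have "continuous_on (cball c B) (\<lambda>y. c - arctan_sum R k y)"
      unfolding arctan_sum_def by (intro continuous_intros) (use pos in force)
    with maps \<open>0 \<le> B\<close> obtain y where "c - arctan_sum R k y = y"
      using brouwer[of "cball c B" "\<lambda>y. c - arctan_sum R k y"] by auto
    then show ?thesis
      by (metis diff_add_cancel)
  qed
  then show "surj (\<lambda>\<xi>. \<xi> + arctan_sum R k \<xi>)"
    by (metis surjI)
qed

section \<open>Reflections and the Weyl group\<close>

lemma inner_coroot: "\<xi> \<bullet> coroot \<alpha> = 2 * (\<xi> \<bullet> \<alpha>) / (\<alpha> \<bullet> \<alpha>)"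
  by (simp add: coroot_def power2_norm_eq_inner)

lemma coroot_inner_self:
  assumes "\<alpha> \<noteq> 0"
  shows "\<alpha> \<bullet> coroot \<alpha> = 2"
  using assms by (simp add: inner_coroot)

lemma root_reflection_altdef: "root_reflection \<alpha> \<xi> = \<xi> - (\<xi> \<bullet> \<alpha>) *\<^sub>R coroot \<alpha>"
  by (simp add: root_reflection_def coroot_def)

lemma linear_root_reflection: "linear (root_reflection \<alpha>)"
  by (rule linearI) (auto simp: root_reflection_def inner_add_left algebra_simps)

lemma root_reflection_self:
  assumes "\<alpha> \<noteq> 0"
  shows "root_reflection \<alpha> \<alpha> = - \<alpha>"
  using coroot_inner_self[OF assms] by (simp add: root_reflection_def scaleR_2)

lemma root_reflection_involution [simp]: "root_reflection \<alpha> (root_reflection \<alpha> \<xi>) = \<xi>"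
proof (cases "\<alpha> = 0")
  case False
  then show ?thesis
    using coroot_inner_self[OF False]
    by (simp add: root_reflection_def inner_diff_left algebra_simps scaleR_2)
qed (simp add: root_reflection_def)

text \<open>The subtracted term, paired with \<eta>, is symmetric in \<xi> and \<eta>. Together with
  the involution property this makes reflections isometries.\<close>

lemma inner_root_reflection: "root_reflection \<alpha> \<xi> \<bullet> \<eta> = \<xi> \<bullet> root_reflection \<alpha> \<eta>"
  by (simp add: root_reflection_def inner_coroot inner_diff_left inner_diff_right inner_commute)

lemma norm_root_reflection [simp]: "norm (root_reflection \<alpha> \<xi>) = norm \<xi>"
  by (simp add: norm_eq_sqrt_inner inner_root_reflection)

lemma coroot_root_reflection: "coroot (root_reflection \<alpha> \<beta>) = root_reflection \<alpha> (coroot \<beta>)"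
  by (simp add: coroot_def linear_scale[OF linear_root_reflection])

lemma coroot_root_reflection':
  "coroot (root_reflection \<alpha> \<beta>) = coroot \<beta> - (\<alpha> \<bullet> coroot \<beta>) *\<^sub>R coroot \<alpha>"
  unfolding coroot_root_reflection by (simp add: root_reflection_altdef inner_commute)

lemma coroot_uminus: "coroot (- \<alpha>) = - coroot \<alpha>"
  by (simp add: coroot_def)

text \<open>The inductive definition only multiplies on the left; adjoints reverse the order of the
  factors and need the right-hand version.\<close>

lemma weyl_group_reflect_right:
  assumes "w \<in> weyl_group R" "\<alpha> \<in> R"
  shows "w \<circ> root_reflection \<alpha> \<in> weyl_group R"
  using assms
proof induction
  case id
  then show ?case
    using weyl_group.reflect[OF _ weyl_group.id] by (simp add: comp_def id_def)
next
  case (reflect \<beta> w)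
  then show ?case
    by (metis comp_assoc weyl_group.reflect)
qed

lemma root_reflection_mem_weyl_group:
  assumes "\<alpha> \<in> R"
  shows "root_reflection \<alpha> \<in> weyl_group R"
  using weyl_group.reflect[OF assms weyl_group.id] by simp

lemma linear_weyl_group:
  assumes "w \<in> weyl_group R"
  shows "linear w"
  using assms
proof induction
  case (reflect \<alpha> w)
  then show ?case
    using linear_compose linear_root_reflection by blast
qed (rule linear_id)

text \<open>Reflections are self-adjoint, so the adjoint of a product of reflections is the product
  in reverse order. This \<open>w'\<close> stands in for the inverse of \<open>w\<close>.\<close>

lemma weyl_group_adjoint:
  assumes "w \<in> weyl_group R"
  shows "\<exists>w'\<in>weyl_group R. \<forall>\<xi> \<eta>. w \<xi> \<bullet> \<eta> = \<xi> \<bullet> w' \<eta>"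
  using assms
proof induction
  case id
  show ?case
    by (rule bexI[OF _ weyl_group.id]) simp
next
  case (reflect \<alpha> w)
  then obtain w' where "w' \<in> weyl_group R" "\<forall>\<xi> \<eta>. w \<xi> \<bullet> \<eta> = \<xi> \<bullet> w' \<eta>"
    by blast
  then show ?case
    using reflect.hyps by (intro bexI[of _ "w' \<circ> root_reflection \<alpha>"])
      (auto simp: inner_root_reflection weyl_group_reflect_right)
qed

lemma norm_weyl_group:
  assumes "w \<in> weyl_group R"
  shows "norm (w \<xi>) = norm \<xi>"
  using assms by induction auto

lemma coroot_weyl_group:
  assumes "w \<in> weyl_group R"
  shows "coroot (w \<beta>) = w (coroot \<beta>)"
  using assms by induction (auto simp: coroot_root_reflection)

lemma weyl_group_root:
  assumes "root_system R" "w \<in> weyl_group R" "\<beta> \<in> R"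
  shows "w \<beta> \<in> R"
  using assms(2) by induction (use assms in \<open>auto simp: root_system_def\<close>)

lemma root_system_uminus:
  assumes "root_system R" "\<alpha> \<in> R"
  shows "- \<alpha> \<in> R"
  using assms root_reflection_self[of \<alpha>] unfolding root_system_def by metis

lemma bij_betw_root_reflection:
  assumes "root_system R" "\<alpha> \<in> R"
  shows "bij_betw (root_reflection \<alpha>) R R"
  using assms unfolding root_system_def
  by (intro bij_betw_byWitness[where f' = "root_reflection \<alpha>"]) auto

lemma multiplicity_function_root_reflection:
  assumes "multiplicity_function R k" "\<alpha> \<in> R" "\<beta> \<in> R"
  shows "k (root_reflection \<alpha> \<beta>) = k \<beta>"
  using assms root_reflection_mem_weyl_group unfolding multiplicity_function_def by blast

lemma multiplicity_function_uminus:
  assumes "root_system R" "multiplicity_function R k" "\<alpha> \<in> R"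
  shows "k (- \<alpha>) = k \<alpha>"
  using multiplicity_function_root_reflection[OF assms(2,3,3)] root_reflection_self[of \<alpha>] assms
  unfolding root_system_def by metis

text \<open>A reflection permutes the roots and preserves \<open>k\<close>, so equivariance is a
  reindexing of the sum, checked on generators.\<close>

lemma arctan_sum_weyl_group:
  assumes "root_system R" "multiplicity_function R k" "w \<in> weyl_group R"
  shows "arctan_sum R k (w \<xi>) = w (arctan_sum R k \<xi>)"
  using assms(3)
proof induction
  case (reflect \<alpha> w)
  have "root_reflection \<alpha> (arctan_sum R k \<xi>) = arctan_sum R k (root_reflection \<alpha> \<xi>)" for \<xi>
  proof -
    have "root_reflection \<alpha> (arctan_sum R k \<xi>) =
        (\<Sum>\<beta>\<in>R. arctan (\<xi> \<bullet> coroot \<beta> / k \<beta>) *\<^sub>R root_reflection \<alpha> \<beta>)"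
      by (simp add: arctan_sum_def linear_sum[OF linear_root_reflection]
          linear_scale[OF linear_root_reflection])
    \<comment> \<open>Reflecting both sides of the pairing does not change it, which puts the
      summand in a form depending only on the reflected root.\<close>
    also have "\<dots> = (\<Sum>\<beta>\<in>R. arctan (root_reflection \<alpha> \<xi> \<bullet> coroot (root_reflection \<alpha> \<beta>) /
        k (root_reflection \<alpha> \<beta>)) *\<^sub>R root_reflection \<alpha> \<beta>)"
      by (intro sum.cong refl)
        (simp add: coroot_root_reflection inner_root_reflection
          multiplicity_function_root_reflection[OF assms(2) reflect.hyps(1)])
    also have "\<dots> = arctan_sum R k (root_reflection \<alpha> \<xi>)"
      unfolding arctan_sum_def
      by (rule sum.reindex_bij_betw[OF bij_betw_root_reflection[OF assms(1) reflect.hyps(1)]])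
    finally show ?thesis .
  qed
  with reflect.IH show ?case
    by (metis comp_apply)
qed simp

lemma weight_lattice_weyl_group:
  assumes "root_system R" "w \<in> weyl_group R" "\<mu> \<in> weight_lattice R"
  shows "w \<mu> \<in> weight_lattice R"
  unfolding weight_lattice_def
proof safe
  fix \<alpha> assume "\<alpha> \<in> R"
  obtain w' where w': "w' \<in> weyl_group R" "\<forall>\<xi> \<eta>. w \<xi> \<bullet> \<eta> = \<xi> \<bullet> w' \<eta>"
    using weyl_group_adjoint[OF assms(2)] by blast
  have "w \<mu> \<bullet> coroot \<alpha> = \<mu> \<bullet> coroot (w' \<alpha>)"
    using w' by (simp add: coroot_weyl_group)
  also have "\<dots> \<in> \<int>"
    using assms weyl_group_root[OF assms(1) w'(1) \<open>\<alpha> \<in> R\<close>] by (simp add: weight_lattice_def)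
  finally show "w \<mu> \<bullet> coroot \<alpha> \<in> \<int>" .
qed

section \<open>The highest root\<close>

locale highest_root_system =
  fixes R \<Delta> :: "'a::euclidean_space set" and \<phi> :: 'a
  assumes root_system: "root_system R" and irreducible: "irreducible_roots R"
    and reduced: "reduced_roots R" and crystallographic: "crystallographic R"
    and basis: "root_basis R \<Delta>" and highest: "highest_root R \<Delta> \<phi>"
begin

text \<open>The sum of the coefficients over the simple roots, built as a linear map on the whole
  space so that it can be applied to any combination of roots.\<close>

definition height :: "'a \<Rightarrow> real" where
  "height = real_vector.construct \<Delta> (\<lambda>_. 1)"

lemma finite_roots: "finite R"
  using root_system by (simp add: root_system_def)

lemma root_nonzero: "\<alpha> \<in> R \<Longrightarrow> \<alpha> \<noteq> 0"
  using root_system by (auto simp: root_system_def)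

lemma root_reflection_root: "\<alpha> \<in> R \<Longrightarrow> \<beta> \<in> R \<Longrightarrow> root_reflection \<alpha> \<beta> \<in> R"
  using root_system by (auto simp: root_system_def)

lemma uminus_root: "\<alpha> \<in> R \<Longrightarrow> - \<alpha> \<in> R"
  using root_system_uminus[OF root_system] .

lemma highest_root: "\<phi> \<in> R"
  using highest by (simp add: highest_root_def)

lemma basis_subset: "\<Delta> \<subseteq> R"
  using basis by (simp add: root_basis_def)

lemma finite_basis: "finite \<Delta>"
  using finite_subset[OF basis_subset finite_roots] .

lemma inner_coroot_integer: "\<alpha> \<in> R \<Longrightarrow> \<beta> \<in> R \<Longrightarrow> \<beta> \<bullet> coroot \<alpha> \<in> \<int>"
  using crystallographic by (simp add: crystallographic_def)

lemma linear_height: "linear height"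
  unfolding height_def by (rule linear_construct) (use basis in \<open>simp add: root_basis_def\<close>)

lemma height_basis: "\<delta> \<in> \<Delta> \<Longrightarrow> height \<delta> = 1"
  unfolding height_def using basis by (simp add: root_basis_def construct_basis)

lemmas height_simps = linear_add[OF linear_height] linear_diff[OF linear_height]
  linear_neg[OF linear_height] linear_scale[OF linear_height]

lemma height_nonneg:
  assumes "v \<in> nonneg_combinations \<Delta>"
  shows "0 \<le> height v"
  using assms
  by (auto simp: nonneg_combinations_def linear_sum[OF linear_height] height_simps height_basis
      intro!: sum_nonneg)

text \<open>The height is the sum of the nonnegative coefficients, so all of them vanish with
  it.\<close>

lemma nonneg_combinations_height_zero:
  assumes "v \<in> nonneg_combinations \<Delta>" "height v = 0"
  shows "v = 0"
proof -
  obtain c :: "'a \<Rightarrow> nat" where c: "v = (\<Sum>\<delta>\<in>\<Delta>. of_nat (c \<delta>) *\<^sub>R \<delta>)"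
    using assms(1) by (auto simp: nonneg_combinations_def)
  then have "(\<Sum>\<delta>\<in>\<Delta>. real (c \<delta>)) = 0"
    using assms(2) by (simp add: linear_sum[OF linear_height] height_simps height_basis)
  then show ?thesis
    unfolding c by (simp add: sum_nonneg_eq_0_iff[OF finite_basis])
qed

lemma root_cases:
  assumes "\<alpha> \<in> R"
  shows "\<alpha> \<in> nonneg_combinations \<Delta> \<or> - \<alpha> \<in> nonneg_combinations \<Delta>"
proof -
  obtain c :: "'a \<Rightarrow> int" where c: "\<alpha> = (\<Sum>\<delta>\<in>\<Delta>. of_int (c \<delta>) *\<^sub>R \<delta>)"
    and sgn: "(\<forall>\<delta>\<in>\<Delta>. 0 \<le> c \<delta>) \<or> (\<forall>\<delta>\<in>\<Delta>. c \<delta> \<le> 0)"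
    using basis assms unfolding root_basis_def by blast
  from sgn show ?thesis
  proof
    assume "\<forall>\<delta>\<in>\<Delta>. 0 \<le> c \<delta>"
    then have "\<alpha> = (\<Sum>\<delta>\<in>\<Delta>. of_nat (nat (c \<delta>)) *\<^sub>R \<delta>)"
      unfolding c by (intro sum.cong) auto
    then have "\<alpha> \<in> nonneg_combinations \<Delta>"
      unfolding nonneg_combinations_def by fast
    then show ?thesis ..
  next
    assume "\<forall>\<delta>\<in>\<Delta>. c \<delta> \<le> 0"
    then have "- \<alpha> = (\<Sum>\<delta>\<in>\<Delta>. of_nat (nat (- c \<delta>)) *\<^sub>R \<delta>)"
      unfolding c sum_negf[symmetric] by (intro sum.cong) auto
    then have "- \<alpha> \<in> nonneg_combinations \<Delta>"
      unfolding nonneg_combinations_def by fast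
    then show ?thesis ..
  qed
qed

lemma height_root_nonzero:
  assumes "\<alpha> \<in> R"
  shows "height \<alpha> \<noteq> 0"
  using root_cases[OF assms] nonneg_combinations_height_zero[of \<alpha>]
    nonneg_combinations_height_zero[of "- \<alpha>"] root_nonzero[OF assms]
  by (auto simp: height_simps)

text \<open>Turns positivity of a root into the sign of a linear functional, which is easy to follow
  through a reflection.\<close>

lemma positive_roots_height: "positive_roots R \<Delta> = {\<alpha>\<in>R. 0 < height \<alpha>}"
  using height_nonneg root_cases height_root_nonzero
  by (fastforce simp: positive_roots_def height_simps less_le)

text \<open>The roots are the disjoint union of the positive ones and their negatives. This matches
  the sum over all roots in the gradient with the product over positive roots in the Bethe
  equations.\<close>

lemma sum_roots_even:
  fixes f :: "'a \<Rightarrow> real"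
  assumes "\<And>\<alpha>. \<alpha> \<in> R \<Longrightarrow> f (- \<alpha>) = f \<alpha>"
  shows "sum f R = 2 * sum f (positive_roots R \<Delta>)"
proof -
  have R: "R = positive_roots R \<Delta> \<union> uminus ` positive_roots R \<Delta>"
  proof
    show "R \<subseteq> positive_roots R \<Delta> \<union> uminus ` positive_roots R \<Delta>"
    proof
      fix \<alpha> assume "\<alpha> \<in> R"
      then have "\<alpha> \<in> positive_roots R \<Delta> \<or> - \<alpha> \<in> positive_roots R \<Delta>"
        using root_cases uminus_root by (auto simp: positive_roots_def)
      then show "\<alpha> \<in> positive_roots R \<Delta> \<union> uminus ` positive_roots R \<Delta>"
        by (metis Un_iff image_eqI minus_minus)
    qed
  qed (use uminus_root in \<open>auto simp: positive_roots_def\<close>)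
  have fin: "finite (positive_roots R \<Delta>)"
    using finite_roots by (simp add: positive_roots_def)
  have "positive_roots R \<Delta> \<inter> uminus ` positive_roots R \<Delta> = {}"
    by (auto simp: positive_roots_height height_simps)
  then have "sum f R = sum f (positive_roots R \<Delta>) + sum f (uminus ` positive_roots R \<Delta>)"
    by (subst R) (rule sum.union_disjoint, use fin in auto)
  also have "sum f (uminus ` positive_roots R \<Delta>) = sum f (positive_roots R \<Delta>)"
    using assms by (subst sum.reindex) (auto simp: inj_on_def positive_roots_def intro!: sum.cong)
  finally show ?thesis
    by simp
qed

section \<open>Dominance and maximal length of the highest root\<close>

lemma height_le_highest: "\<alpha> \<in> R \<Longrightarrow> height \<alpha> \<le> height \<phi>"
  using height_nonneg[of "\<phi> - \<alpha>"] highest by (auto simp: highest_root_def height_simps)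

lemma height_highest_pos: "0 < height \<phi>"
  using height_le_highest[OF uminus_root[OF highest_root]] height_root_nonzero[OF highest_root]
  by (simp add: height_simps)

text \<open>As \<delta> has height 1, reflecting in it lowers the height of \<gamma> by exactly the
  pairing of \<gamma> with the coroot of \<delta>.\<close>

lemma inner_nonneg_of_height_reflection_le:
  assumes "height (root_reflection \<delta> \<gamma>) \<le> height \<gamma>" "\<delta> \<in> \<Delta>"
  shows "0 \<le> \<gamma> \<bullet> \<delta>"
proof -
  have "0 \<le> \<gamma> \<bullet> coroot \<delta>"
    using assms by (simp add: root_reflection_def height_simps height_basis)
  moreover have "0 < \<delta> \<bullet> \<delta>"
    using assms root_nonzero basis_subset by auto
  ultimately show ?thesis
    by (simp add: inner_coroot zero_le_divide_iff)
qed

lemma inner_nonneg_combination: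
  assumes "v \<in> nonneg_combinations \<Delta>" "\<And>\<delta>. \<delta> \<in> \<Delta> \<Longrightarrow> 0 \<le> u \<bullet> \<delta>"
  shows "0 \<le> u \<bullet> v"
  using assms by (auto simp: nonneg_combinations_def inner_sum_right intro!: sum_nonneg)

text \<open>
  A root of maximal height in the Weyl orbit of \<open>\<alpha>\<close> is dominant, and so
  is \<open>\<phi>\<close>; for dominant \<open>\<gamma>\<close> with \<open>\<phi> - \<gamma>\<close> nonnegative,
  \<open>\<phi> \<bullet> \<phi> - \<gamma> \<bullet> \<gamma> = (\<phi> + \<gamma>) \<bullet> (\<phi> - \<gamma>) \<ge> 0\<close>.
\<close>
lemma norm_le_highest:
  assumes "\<alpha> \<in> R"
  shows "norm \<alpha> \<le> norm \<phi>"
proof -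
  define orbit where "orbit = (\<lambda>w. w \<alpha>) ` weyl_group R"
  have orbit_roots: "orbit \<subseteq> R"
    using weyl_group_root[OF root_system _ assms] by (auto simp: orbit_def)
  then have "finite orbit"
    using finite_roots finite_subset by blast
  moreover have "orbit \<noteq> {}"
    using weyl_group.id by (auto simp: orbit_def)
  ultimately obtain \<gamma> where \<gamma>: "\<gamma> \<in> orbit" "\<And>\<beta>. \<beta> \<in> orbit \<Longrightarrow> height \<beta> \<le> height \<gamma>"
    by (metis obtains_MAX Max_ge finite_imageI imageI)
  have "root_reflection \<delta> \<gamma> \<in> orbit" if "\<delta> \<in> \<Delta>" for \<delta>
  proof -
    obtain w where "w \<in> weyl_group R" "\<gamma> = w \<alpha>"
      using \<gamma>(1) by (auto simp: orbit_def)
    moreover have "\<delta> \<in> R"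
      using that basis_subset by auto
    ultimately show ?thesis
      unfolding orbit_def by (intro image_eqI[OF _ weyl_group.reflect]) simp_all
  qed
  then have dominant: "0 \<le> \<gamma> \<bullet> \<delta>" if "\<delta> \<in> \<Delta>" for \<delta>
    using inner_nonneg_of_height_reflection_le \<gamma>(2) that by blast
  have "0 \<le> \<phi> \<bullet> \<delta>" if "\<delta> \<in> \<Delta>" for \<delta>
    using that basis_subset highest_root
    by (intro inner_nonneg_of_height_reflection_le height_le_highest root_reflection_root) auto
  with dominant have "0 \<le> (\<phi> + \<gamma>) \<bullet> \<delta>" if "\<delta> \<in> \<Delta>" for \<delta>
    using that by (simp add: inner_add_left)
  moreover have "\<phi> - \<gamma> \<in> nonneg_combinations \<Delta>"
    using highest \<gamma>(1) orbit_roots by (auto simp: highest_root_def)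
  ultimately have "0 \<le> (\<phi> + \<gamma>) \<bullet> (\<phi> - \<gamma>)"
    by (metis inner_nonneg_combination)
  then have "\<gamma> \<bullet> \<gamma> \<le> \<phi> \<bullet> \<phi>"
    by (simp add: inner_add_left inner_diff_right inner_commute[of \<gamma> \<phi>])
  then have "norm \<gamma> \<le> norm \<phi>"
    by (simp add: norm_le)
  moreover have "norm \<gamma> = norm \<alpha>"
    using \<gamma>(1) norm_weyl_group by (auto simp: orbit_def)
  ultimately show ?thesis
    by simp
qed

section \<open>The weight lattice tested on conjugates of the highest coroot\<close>

text \<open>The roots not orthogonal to the whole orbit of \<phi> are orthogonal to the remaining
  roots. They include \<phi>, so irreducibility leaves no remaining roots.\<close>

lemma ex_conjugate_highest_nonorthogonal:
  assumes "\<alpha> \<in> R"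
  shows "\<exists>w\<in>weyl_group R. w \<phi> \<bullet> \<alpha> \<noteq> 0"
proof (rule ccontr)
  assume *: "\<not> ?thesis"
  define A where "A = {\<alpha>\<in>R. \<exists>w\<in>weyl_group R. w \<phi> \<bullet> \<alpha> \<noteq> 0}"
  have "\<phi> \<in> A"
    using highest_root root_nonzero by (auto simp: A_def intro!: bexI[OF _ weyl_group.id])
  moreover have "\<alpha> \<in> R - A"
    using * assms by (auto simp: A_def)
  moreover have "\<beta> \<bullet> \<gamma> = 0" if "\<beta> \<in> A" "\<gamma> \<in> R - A" for \<beta> \<gamma>
  proof -
    obtain w where w: "w \<in> weyl_group R" "w \<phi> \<bullet> \<beta> \<noteq> 0" and \<beta>: "\<beta> \<in> R"
      using \<open>\<beta> \<in> A\<close> by (auto simp: A_def)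
    have orth: "w \<phi> \<bullet> \<gamma> = 0" if "w \<in> weyl_group R" for w
      using that \<open>\<gamma> \<in> R - A\<close> by (auto simp: A_def)
    \<comment> \<open>The reflected vector is again a conjugate of \<phi>, hence orthogonal to
      \<gamma>; it differs from \<open>w \<phi>\<close> by a nonzero multiple of \<beta>.\<close>
    have "root_reflection \<beta> (w \<phi>) \<bullet> \<gamma> = 0"
      using orth[OF weyl_group.reflect[OF \<beta> w(1)]] by simp
    then have "(w \<phi> \<bullet> coroot \<beta>) * (\<beta> \<bullet> \<gamma>) = 0"
      using orth[OF w(1)] by (simp add: root_reflection_def inner_diff_left)
    moreover have "w \<phi> \<bullet> coroot \<beta> \<noteq> 0"
      using w(2) root_nonzero[OF \<beta>] by (simp add: inner_coroot)
    ultimately show ?thesis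
      by simp
  qed
  moreover have "A \<union> (R - A) = R" "A \<inter> (R - A) = {}"
    by (auto simp: A_def)
  ultimately show False
    using irreducible unfolding irreducible_roots_def by (metis empty_iff)
qed

text \<open>The pairing is a nonzero integer, and Cauchy-Schwarz bounds it by 2 in absolute value
  because \<beta> is at least as long as \<alpha>. The value 2 is the equality case, where the roots
  agree up to sign.\<close>

lemma inner_coroot_longer_root:
  assumes "\<alpha> \<in> R" "\<beta> \<in> R" "norm \<alpha> \<le> norm \<beta>" "\<beta> \<bullet> \<alpha> \<noteq> 0"
  shows "\<alpha> = \<beta> \<or> \<alpha> = - \<beta> \<or> \<alpha> \<bullet> coroot \<beta> = 1 \<or> \<alpha> \<bullet> coroot \<beta> = -1"
proof -
  obtain n :: int where n: "\<alpha> \<bullet> coroot \<beta> = of_int n"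
    using inner_coroot_integer[OF assms(2,1)] by (auto elim: Ints_cases)
  have "\<beta> \<noteq> 0" "\<alpha> \<noteq> 0"
    using assms root_nonzero by auto
  then have n_inner: "2 * (\<alpha> \<bullet> \<beta>) = of_int n * (norm \<beta>)\<^sup>2"
    using n by (simp add: inner_coroot field_simps power2_norm_eq_inner)
  have "n \<noteq> 0"
    using n_inner assms(4) \<open>\<beta> \<noteq> 0\<close> by (auto simp: inner_commute)
  have cauchy: "\<bar>\<alpha> \<bullet> \<beta>\<bar> \<le> norm \<alpha> * norm \<beta>"
    by (rule Cauchy_Schwarz_ineq2)
  also have "\<dots> \<le> (norm \<beta>)\<^sup>2"
    using assms(3) by (simp add: power2_eq_square mult_right_mono)
  finally have "\<bar>of_int n :: real\<bar> * (norm \<beta>)\<^sup>2 \<le> 2 * (norm \<beta>)\<^sup>2"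
    using arg_cong[OF n_inner, of abs] by (simp add: abs_mult)
  then have "\<bar>n\<bar> \<le> 2"
    using \<open>\<beta> \<noteq> 0\<close> by simp
  show ?thesis
  proof (cases "\<bar>n\<bar> = 2")
    case True
    then have eq: "\<bar>\<alpha> \<bullet> \<beta>\<bar> = (norm \<beta>)\<^sup>2"
      using arg_cong[OF n_inner, of abs] by (simp add: abs_mult flip: of_int_abs)
    with cauchy have "norm \<beta> \<le> norm \<alpha>"
      using \<open>\<beta> \<noteq> 0\<close> by (simp add: power2_eq_square)
    with assms(3) have "norm \<alpha> = norm \<beta>"
      by simp
    with eq have "\<bar>\<alpha> \<bullet> \<beta>\<bar> = norm \<alpha> * norm \<beta>"
      by (simp add: power2_eq_square)
    then have "norm \<alpha> *\<^sub>R \<beta> = norm \<beta> *\<^sub>R \<alpha> \<or> norm \<alpha> *\<^sub>R \<beta> = - norm \<beta> *\<^sub>R \<alpha>"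
      using norm_cauchy_schwarz_abs_eq by blast
    then show ?thesis
      using \<open>norm \<alpha> = norm \<beta>\<close> \<open>\<beta> \<noteq> 0\<close>
      by (metis (no_types, opaque_lifting) minus_minus norm_eq_zero scaleR_cancel_left
          scaleR_minus_left scaleR_minus_right)
  next
    case False
    then have "n = 1 \<or> n = -1"
      using \<open>\<bar>n\<bar> \<le> 2\<close> \<open>n \<noteq> 0\<close> by linarith
    then show ?thesis
      using n by auto
  qed
qed

text \<open>Given \<alpha>, take a conjugate \<beta> of \<phi> not orthogonal to it. Either \<alpha>
  is \<beta> up to sign, or \<alpha> pairs to 1 or -1 with the coroot of \<beta>; then reflecting
  \<beta> in \<alpha> changes its coroot by the coroot of \<alpha> up to sign, which is thus a
  difference of coroots of conjugates.\<close>

lemma weight_lattice_iff_highest: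
  "x \<in> weight_lattice R \<longleftrightarrow> (\<forall>w\<in>weyl_group R. w x \<bullet> coroot \<phi> \<in> \<int>)"
proof
  assume "x \<in> weight_lattice R"
  then show "\<forall>w\<in>weyl_group R. w x \<bullet> coroot \<phi> \<in> \<int>"
    using weight_lattice_weyl_group[OF root_system] highest_root by (auto simp: weight_lattice_def)
next
  assume *: "\<forall>w\<in>weyl_group R. w x \<bullet> coroot \<phi> \<in> \<int>"
  \<comment> \<open>Moving \<open>w\<close> to the other side of the inner product turns a condition
    on the orbit of \<open>x\<close> into one on the orbit of \<phi>.\<close>
  have conj: "x \<bullet> coroot (w \<phi>) \<in> \<int>" if w: "w \<in> weyl_group R" for w
  proof -
    obtain w' where "w' \<in> weyl_group R" "\<forall>\<xi> \<eta>. w \<xi> \<bullet> \<eta> = \<xi> \<bullet> w' \<eta>"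
      using weyl_group_adjoint[OF w] by blast
    then show ?thesis
      using * coroot_weyl_group[OF w] by (metis inner_commute)
  qed
  show "x \<in> weight_lattice R"
    unfolding weight_lattice_def
  proof safe
    fix \<alpha> assume \<alpha>: "\<alpha> \<in> R"
    obtain w where w: "w \<in> weyl_group R" "w \<phi> \<bullet> \<alpha> \<noteq> 0"
      using ex_conjugate_highest_nonorthogonal[OF \<alpha>] by blast
    have \<beta>: "w \<phi> \<in> R"
      using weyl_group_root[OF root_system w(1) highest_root] .
    have "norm \<alpha> \<le> norm (w \<phi>)"
      using norm_le_highest[OF \<alpha>] norm_weyl_group[OF w(1)] by simp
    then consider "\<alpha> = w \<phi>" | "\<alpha> = - w \<phi>" |
      "\<alpha> \<bullet> coroot (w \<phi>) = 1" | "\<alpha> \<bullet> coroot (w \<phi>) = -1"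
      using inner_coroot_longer_root[OF \<alpha> \<beta> _ w(2)] by blast
    then show "x \<bullet> coroot \<alpha> \<in> \<int>"
    proof cases
      case 1
      then show ?thesis
        using conj[OF w(1)] by simp
    next
      case 2
      then show ?thesis
        using conj[OF w(1)] by (simp add: coroot_uminus)
    next
      case 3
      have "x \<bullet> coroot (root_reflection \<alpha> (w \<phi>)) \<in> \<int>"
        using conj[OF weyl_group.reflect[OF \<alpha> w(1)]] by simp
      then have "x \<bullet> coroot (w \<phi>) - x \<bullet> coroot \<alpha> \<in> \<int>"
        using 3 by (simp add: coroot_root_reflection' inner_diff_right inner_add_right)
      then show ?thesis
        using Ints_diff[OF conj[OF w(1)]] by fastforce
    next
      case 4
      have "x \<bullet> coroot (root_reflection \<alpha> (w \<phi>)) \<in> \<int>"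
        using conj[OF weyl_group.reflect[OF \<alpha> w(1)]] by simp
      then have "x \<bullet> coroot (w \<phi>) + x \<bullet> coroot \<alpha> \<in> \<int>"
        using 4 by (simp add: coroot_root_reflection' inner_diff_right inner_add_right)
      then show ?thesis
        using Ints_diff[OF _ conj[OF w(1)]] by fastforce
    qed
  qed
qed

text \<open>
  The roots counted with odd coefficient are paired off by \<open>\<alpha> \<mapsto> - s\<^sub>\<phi> \<alpha>\<close>, which has no fixed point
  since a fixed \<open>\<alpha>\<close> would be an odd multiple of \<open>\<phi>/2\<close>.
\<close>
lemma even_sum_positive_roots: "even (\<Sum>\<alpha>\<in>positive_roots R \<Delta>. \<lfloor>\<alpha> \<bullet> coroot \<phi>\<rfloor>)"
proof -
  define X where "X = {\<alpha>\<in>positive_roots R \<Delta>. odd \<lfloor>\<alpha> \<bullet> coroot \<phi>\<rfloor>}"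
  define h where "h \<alpha> = - root_reflection \<phi> \<alpha>" for \<alpha>
  have "\<phi> \<noteq> 0"
    using root_nonzero[OF highest_root] .
  have h_inner: "h \<alpha> \<bullet> coroot \<phi> = \<alpha> \<bullet> coroot \<phi>" for \<alpha>
    using coroot_inner_self[OF \<open>\<phi> \<noteq> 0\<close>] by (simp add: h_def root_reflection_def inner_diff_left)
  have floor: "\<alpha> \<bullet> coroot \<phi> = of_int \<lfloor>\<alpha> \<bullet> coroot \<phi>\<rfloor>" if "\<alpha> \<in> R" for \<alpha>
    using inner_coroot_integer[OF highest_root that] by simp
  have "h \<alpha> \<in> X" if "\<alpha> \<in> X" for \<alpha>
  proof -
    define n where "n = \<lfloor>\<alpha> \<bullet> coroot \<phi>\<rfloor>"
    have \<alpha>: "\<alpha> \<in> R" "0 < height \<alpha>" "odd n"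
      using that by (auto simp: X_def positive_roots_height n_def)
    have h: "h \<alpha> = of_int n *\<^sub>R \<phi> - \<alpha>"
      using floor[OF \<alpha>(1)] by (simp add: h_def root_reflection_def n_def)
    have "h \<alpha> \<in> R"
      using \<alpha>(1) uminus_root root_reflection_root[OF highest_root] by (simp add: h_def)
    \<comment> \<open>For negative \<open>n\<close> the root \<open>- h \<alpha>\<close>, which is
      \<alpha> plus a positive multiple of \<phi>, would be higher than \<phi>.\<close>
    have "0 < n"
    proof (rule ccontr)
      assume "\<not> 0 < n"
      with \<alpha>(3) have "n \<le> -1"
        by presburger
      then have "1 * height \<phi> \<le> - of_int n * height \<phi>"
        using height_highest_pos by (intro mult_right_mono) auto
      then have "height \<phi> \<le> - of_int n * height \<phi>"
        by simp
      also have "\<dots> < height (- h \<alpha>)"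
        using \<alpha>(2) by (simp add: h height_simps)
      finally show False
        using height_le_highest[OF uminus_root[OF \<open>h \<alpha> \<in> R\<close>]] by simp
    qed
    \<comment> \<open>With \<open>n\<close> at least 1, the height of \<open>h \<alpha>\<close> is
      at least that of \<phi> minus that of \<alpha>, so \<open>h \<alpha>\<close> is again
      positive.\<close>
    then have "height \<phi> \<le> of_int n * height \<phi>"
      using height_highest_pos by simp
    then have "0 \<le> height (h \<alpha>)"
      using height_le_highest[OF \<alpha>(1)] by (simp add: h height_simps)
    then have "0 < height (h \<alpha>)"
      using height_root_nonzero[OF \<open>h \<alpha> \<in> R\<close>] by simp
    then show ?thesis
      using \<open>h \<alpha> \<in> R\<close> \<alpha>(3) by (simp add: X_def positive_roots_height h_inner n_def)
  qed
  moreover have "h (h \<alpha>) = \<alpha>" for \<alpha>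
    by (simp add: h_def linear_neg[OF linear_root_reflection])
  moreover have "h \<alpha> \<noteq> \<alpha>" if "\<alpha> \<in> X" for \<alpha>
  proof
    assume fixed: "h \<alpha> = \<alpha>"
    define n where "n = \<lfloor>\<alpha> \<bullet> coroot \<phi>\<rfloor>"
    have \<alpha>: "\<alpha> \<in> R" "odd n"
      using that by (auto simp: X_def positive_roots_def n_def)
    have "2 *\<^sub>R \<alpha> = of_int n *\<^sub>R \<phi>"
      using fixed floor[OF \<alpha>(1)]
      by (simp add: h_def root_reflection_def n_def scaleR_2 algebra_simps)
    then have "\<alpha> = (of_int n / 2) *\<^sub>R \<phi>"
      by (metis (no_types, lifting) divide_inverse_commute divideR_right scaleR_scaleR
          zero_neq_numeral)
    then have "of_int n / 2 = (1::real) \<or> of_int n / 2 = (-1::real)"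
      using reduced highest_root \<alpha>(1) unfolding reduced_roots_def by metis
    then have "n = 2 \<or> n = -2"
      by auto
    with \<alpha>(2) show False
      by auto
  qed
  \<comment> \<open>Over the field with two elements the ones cancel within each pair, so
    \<open>X\<close> has even cardinality; a sum of integers has the parity of its number of odd
    terms.\<close>
  ultimately have "(\<Sum>\<alpha>\<in>X. 1 :: bit) = 0"
    by (intro sum_involution_eq_0[where h = h]) auto
  then have "of_nat (card X) = (0 :: bit)"
    by (simp only: sum_constant mult_1_right)
  then have "even (of_nat (card X) :: bit)"
    by simp
  then have "even (card X)"
    by (simp only: even_of_nat_iff)
  then show ?thesis
    using finite_roots by (simp add: even_sum_iff X_def positive_roots_def)
qed

end

section \<open>The logarithm of the Bethe ansatz equations\<close>

text \<open>In polar form the denominator is \<open>r * cis \<theta>\<close> with \<theta> the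
  arctangent of \<open>x / c\<close>, and the numerator is minus its complex conjugate.\<close>

lemma bethe_factor:
  fixes x c :: real
  assumes "0 < c"
  shows "(Complex 0 x - of_real c) / (Complex 0 x + of_real c) = - exp (- 2 * \<i> * of_real (arctan (x / c)))"
proof -
  define \<theta> where "\<theta> = arctan (x / c)"
  define r where "r = c / cos \<theta>"
  have "cos \<theta> \<noteq> 0"
    by (simp add: \<theta>_def)
  then have c: "r * cos \<theta> = c"
    by (simp add: r_def)
  have "tan \<theta> = x / c"
    by (simp add: \<theta>_def tan_arctan)
  then have x: "r * sin \<theta> = x"
    using assms by (simp add: r_def tan_def field_simps)
  have "r \<noteq> 0"
    using c assms by auto
  have "Complex 0 x - of_real c = - (of_real r * cis (- \<theta>))" "Complex 0 x + of_real c = of_real r * cis \<theta>"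
    using x c by (auto simp: complex_eq_iff)
  then have "(Complex 0 x - of_real c) / (Complex 0 x + of_real c) = - (cis (- \<theta>) / cis \<theta>)"
    using \<open>r \<noteq> 0\<close> by simp
  also have "\<dots> = - cis (- 2 * \<theta>)"
    by (simp add: cis_divide)
  finally show ?thesis
    by (simp add: cis_conv_exp \<theta>_def mult_ac)
qed

lemma prod_minus_one_powi:
  fixes n :: "'b \<Rightarrow> int"
  assumes "finite A"
  shows "(\<Prod>a\<in>A. (-1 :: complex) powi n a) = (-1) powi (\<Sum>a\<in>A. n a)"
  using assms by induction (auto simp: power_int_add)

context highest_root_system
begin

text \<open>Each factor contributes a sign and a phase. The signs multiply to 1, the phases add up
  to the pairing of \<open>arctan_sum\<close> with the coroot of \<phi>, and what remains is that a
  unit complex number equals 1.\<close>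

lemma bethe_equation_iff:
  assumes "multiplicity_function R k"
  shows "exp (complex_eval (imag \<eta>) (coroot \<phi>)) =
      (\<Prod>\<alpha>\<in>positive_roots R \<Delta>.
        ((complex_eval (imag \<eta>) (coroot \<alpha>) - of_real (k \<alpha>)) /
         (complex_eval (imag \<eta>) (coroot \<alpha>) + of_real (k \<alpha>))) powi \<lfloor>\<alpha> \<bullet> coroot \<phi>\<rfloor>) \<longleftrightarrow>
    ((1 / (2 * pi)) *\<^sub>R (\<eta> + arctan_sum R k \<eta>)) \<bullet> coroot \<phi> \<in> \<int>"
    (is "?lhs = ?prod \<longleftrightarrow> ?rhs")
proof -
  define P where "P = positive_roots R \<Delta>"
  define n where "n \<alpha> = \<lfloor>\<alpha> \<bullet> coroot \<phi>\<rfloor>" for \<alpha>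
  define \<theta> where "\<theta> \<alpha> = arctan (\<eta> \<bullet> coroot \<alpha> / k \<alpha>)" for \<alpha>
  define A where "A = arctan_sum R k \<eta> \<bullet> coroot \<phi>"
  have "P \<subseteq> R"
    by (auto simp: P_def positive_roots_def)
  then have "finite P"
    using finite_roots finite_subset by blast
  have n: "of_int (n \<alpha>) = \<alpha> \<bullet> coroot \<phi>" if "\<alpha> \<in> P" for \<alpha>
    using inner_coroot_integer[OF highest_root, of \<alpha>] that \<open>P \<subseteq> R\<close> by (simp add: n_def subset_iff)
  have "A = (\<Sum>\<alpha>\<in>R. \<theta> \<alpha> * (\<alpha> \<bullet> coroot \<phi>))"
    by (simp add: A_def arctan_sum_def inner_sum_left \<theta>_def)
  \<comment> \<open>Replacing \<alpha> by its negative flips both the arctangent and the pairing, so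
    the summand is even.\<close>
  also have "\<dots> = 2 * (\<Sum>\<alpha>\<in>P. \<theta> \<alpha> * (\<alpha> \<bullet> coroot \<phi>))"
    unfolding P_def
    by (rule sum_roots_even)
      (simp add: \<theta>_def coroot_uminus multiplicity_function_uminus[OF root_system assms] arctan_minus)
  also have "\<dots> = (\<Sum>\<alpha>\<in>P. 2 * of_int (n \<alpha>) * \<theta> \<alpha>)"
    by (simp add: sum_distrib_left n mult_ac)
  finally have A: "A = (\<Sum>\<alpha>\<in>P. 2 * of_int (n \<alpha>) * \<theta> \<alpha>)" .
  have "?prod = (\<Prod>\<alpha>\<in>P. (-1) powi n \<alpha> * exp (- \<i> * of_real (2 * of_int (n \<alpha>) * \<theta> \<alpha>)))"
    unfolding P_def[symmetric]
  proof (rule prod.cong)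
    fix \<alpha> assume "\<alpha> \<in> P"
    then have "0 < k \<alpha>"
      using assms \<open>P \<subseteq> R\<close> by (auto simp: multiplicity_function_def)
    then have "(complex_eval (imag \<eta>) (coroot \<alpha>) - of_real (k \<alpha>)) /
        (complex_eval (imag \<eta>) (coroot \<alpha>) + of_real (k \<alpha>)) = - exp (- 2 * \<i> * of_real (\<theta> \<alpha>))"
      using bethe_factor by (simp add: complex_eval_def imag_def \<theta>_def)
    also have "\<dots> powi n \<alpha> = (-1) powi n \<alpha> * exp (- \<i> * of_real (2 * of_int (n \<alpha>) * \<theta> \<alpha>))"
      by (subst power_int_minus_left) (simp add: exp_power_int power_int_minus_left mult_ac)
    finally show "((complex_eval (imag \<eta>) (coroot \<alpha>) - of_real (k \<alpha>)) /
        (complex_eval (imag \<eta>) (coroot \<alpha>) + of_real (k \<alpha>))) powi \<lfloor>\<alpha> \<bullet> coroot \<phi>\<rfloor> =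
        (-1) powi n \<alpha> * exp (- \<i> * of_real (2 * of_int (n \<alpha>) * \<theta> \<alpha>))"
      by (simp only: n_def)
  qed simp
  also have "\<dots> = (-1) powi (\<Sum>\<alpha>\<in>P. n \<alpha>) * exp (\<Sum>\<alpha>\<in>P. - \<i> * of_real (2 * of_int (n \<alpha>) * \<theta> \<alpha>))"
    using \<open>finite P\<close> by (simp only: prod.distrib prod_minus_one_powi exp_sum)
  also have "(-1 :: complex) powi (\<Sum>\<alpha>\<in>P. n \<alpha>) = 1"
    using even_sum_positive_roots by (simp add: P_def n_def)
  also have "(\<Sum>\<alpha>\<in>P. - \<i> * of_real (2 * of_int (n \<alpha>) * \<theta> \<alpha>)) = - \<i> * of_real A"
    unfolding A of_real_sum sum_distrib_left ..
  finally have prod: "?prod = exp (- \<i> * of_real A)"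
    by simp
  have "?lhs = exp (\<i> * of_real (\<eta> \<bullet> coroot \<phi>))"
    by (simp add: complex_eval_def imag_def Complex_eq)
  then have "?lhs = ?prod \<longleftrightarrow>
      exp (\<i> * of_real (\<eta> \<bullet> coroot \<phi>)) / exp (- \<i> * of_real A) = 1"
    by (simp add: prod)
  also have "\<dots> \<longleftrightarrow> exp (\<i> * of_real (\<eta> \<bullet> coroot \<phi> + A)) = 1"
    by (simp add: distrib_left flip: exp_diff)
  also have "\<dots> \<longleftrightarrow> (\<exists>m::int. \<eta> \<bullet> coroot \<phi> + A = of_int (2 * m) * pi)"
    by (simp add: exp_eq_1)
  also have "\<dots> \<longleftrightarrow> (\<exists>m::int. (\<eta> \<bullet> coroot \<phi> + A) / (2 * pi) = of_int m)"
    by (simp add: field_simps)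
  also have "\<dots> \<longleftrightarrow> (\<eta> \<bullet> coroot \<phi> + A) / (2 * pi) \<in> \<int>"
    by (auto elim: Ints_cases)
  also have "(\<eta> \<bullet> coroot \<phi> + A) / (2 * pi) = ((1 / (2 * pi)) *\<^sub>R (\<eta> + arctan_sum R k \<eta>)) \<bullet> coroot \<phi>"
    by (simp add: A_def inner_add_left)
  finally show ?thesis .
qed

text \<open>By equivariance, the equation for \<open>w\<close> says that \<open>w\<close> applied to
  one fixed vector pairs integrally with the coroot of \<phi>; over all \<open>w\<close> this is the
  criterion of \<open>weight_lattice_iff_highest\<close>.\<close>

lemma imag_mem_BAE_iff:
  assumes "multiplicity_function R k"
  shows "imag \<eta> \<in> BAE R \<Delta> \<phi> k \<longleftrightarrow>
    (1 / (2 * pi)) *\<^sub>R (\<eta> + arctan_sum R k \<eta>) \<in> weight_lattice R"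
proof -
  have action: "complex_action w (imag \<eta>) = imag (w \<eta>)" if "w \<in> weyl_group R" for w
    using linear_0[OF linear_weyl_group[OF that]] by (simp add: complex_action_def imag_def)
  have equivariant: "(1 / (2 * pi)) *\<^sub>R (w \<eta> + arctan_sum R k (w \<eta>)) =
      w ((1 / (2 * pi)) *\<^sub>R (\<eta> + arctan_sum R k \<eta>))" if w: "w \<in> weyl_group R" for w
    using linear_add[OF linear_weyl_group[OF w]] linear_scale[OF linear_weyl_group[OF w]]
      arctan_sum_weyl_group[OF root_system assms w] by simp
  show ?thesis
    unfolding BAE_def weight_lattice_iff_highest
    by (simp only: mem_Collect_eq rangeI simp_thms action bethe_equation_iff[OF assms] equivariant
        cong: ball_cong)
qed

end

theorem proposition2p9:
  fixes R \<Delta> :: "'a::euclidean_space set" and \<phi> :: 'a and k :: "'a \<Rightarrow> real"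
  assumes "root_system R" and "irreducible_roots R" and "reduced_roots R" and "crystallographic R"
    and "root_basis R \<Delta>" and "highest_root R \<Delta> \<phi>"
    and "multiplicity_function R k"
  shows "(\<forall>\<mu>\<in>weight_lattice R. \<exists>!\<xi>. is_extremum (master_function R k \<mu>) \<xi>) \<and>
    bij_betw (\<lambda>\<mu>. imag (mu_hat R k \<mu>)) (weight_lattice R) (BAE R \<Delta> \<phi> k) \<and>
    (\<forall>w\<in>weyl_group R. \<forall>\<mu>\<in>weight_lattice R.
       w \<mu> \<in> weight_lattice R \<and>
       imag (mu_hat R k (w \<mu>)) = complex_action w (imag (mu_hat R k \<mu>)))"
proof -
  interpret highest_root_system R \<Delta> \<phi>
    using assms by unfold_locales
  note k = \<open>multiplicity_function R k\<close>
  define G where "G \<xi> = \<xi> + arctan_sum R k \<xi>" for \<xi>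
  have k_pos: "0 < k \<alpha>" if "\<alpha> \<in> R" for \<alpha>
    using k that by (simp add: multiplicity_function_def)
  have extremum: "is_extremum (master_function R k \<mu>) \<xi> \<longleftrightarrow> G \<xi> = (2 * pi) *\<^sub>R \<mu>" for \<mu> \<xi>
    unfolding G_def by (rule is_extremum_master_function_iff) (rule k_pos)
  have "bij G"
    unfolding G_def using bij_add_arctan_sum[where R = R and k = k, OF k_pos] .
  then have unique: "\<exists>!\<xi>. is_extremum (master_function R k \<mu>) \<xi>" for \<mu>
    unfolding extremum by (metis bij_pointE)
  have G_mu_hat: "G (mu_hat R k \<mu>) = (2 * pi) *\<^sub>R \<mu>" for \<mu>
    using theI'[OF unique[of \<mu>]] extremum unfolding mu_hat_def by blast
  have mu_hat_eqI: "mu_hat R k \<mu> = \<xi>" if "G \<xi> = (2 * pi) *\<^sub>R \<mu>" for \<mu> \<xi>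
    using that G_mu_hat[of \<mu>] \<open>bij G\<close> by (metis bij_pointE)
  have "bij_betw (\<lambda>\<mu>. imag (mu_hat R k \<mu>)) (weight_lattice R) (BAE R \<Delta> \<phi> k)"
  \<comment> \<open>The inverse map reads the weight off a solution by applying the gradient map to
    its imaginary part and dividing by \<open>2 * pi\<close>.\<close>
  proof (rule bij_betw_byWitness[where f' = "\<lambda>z. (1 / (2 * pi)) *\<^sub>R G (snd z)"])
    show "\<forall>\<mu>\<in>weight_lattice R. (1 / (2 * pi)) *\<^sub>R G (snd (imag (mu_hat R k \<mu>))) = \<mu>"
      by (simp add: imag_def G_mu_hat)
    show "\<forall>z\<in>BAE R \<Delta> \<phi> k. imag (mu_hat R k ((1 / (2 * pi)) *\<^sub>R G (snd z))) = z"
      by (auto simp: BAE_def imag_def intro!: mu_hat_eqI)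
    show "(\<lambda>\<mu>. imag (mu_hat R k \<mu>)) ` weight_lattice R \<subseteq> BAE R \<Delta> \<phi> k"
      using imag_mem_BAE_iff[OF k] G_mu_hat by (auto simp: G_def)
    show "(\<lambda>z. (1 / (2 * pi)) *\<^sub>R G (snd z)) ` BAE R \<Delta> \<phi> k \<subseteq> weight_lattice R"
    proof safe
      fix a b assume z: "(a, b) \<in> BAE R \<Delta> \<phi> k"
      then have "imag b \<in> BAE R \<Delta> \<phi> k"
        by (auto simp: BAE_def imag_def)
      then show "(1 / (2 * pi)) *\<^sub>R G (snd (a, b)) \<in> weight_lattice R"
        using imag_mem_BAE_iff[OF k] by (simp add: G_def)
    qed
  qed
  moreover have "imag (mu_hat R k (w \<mu>)) = complex_action w (imag (mu_hat R k \<mu>))"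
    if w: "w \<in> weyl_group R" for w \<mu>
  proof -
    note linear = linear_weyl_group[OF w]
    \<comment> \<open>By equivariance of \<open>G\<close> the vector
      \<open>w (mu_hat R k \<mu>)\<close> solves the extremum equation for \<open>w \<mu>\<close>,
      so uniqueness identifies it.\<close>
    have "G (w (mu_hat R k \<mu>)) = w (G (mu_hat R k \<mu>))"
      by (simp add: G_def arctan_sum_weyl_group[OF root_system k w] linear_add[OF linear])
    then have "mu_hat R k (w \<mu>) = w (mu_hat R k \<mu>)"
      by (intro mu_hat_eqI) (simp add: G_mu_hat linear_scale[OF linear])
    then show ?thesis
      by (simp add: complex_action_def imag_def linear_0[OF linear])
  qed
  ultimately show ?thesis
    using unique weight_lattice_weyl_group[OF root_system] by blast
qed

end
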